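(* Let $L$ and $M$ be distributive lattices, let $n\in\mathbb{N}$ with $n\geq 2$, and let $T\colon L^n\to M$ be a lattice $n$-homomorphism. If $T$ is symmetric, then its diagonal map $P_T\colon L\to M$, $P_T(x):=T(x,x,\dots,x)$, is a lattice homomorphism.
   Context: A map $T\colon L^n\to M$ between lattices is a lattice $n$-homomorphism if it is a lattice homomorphism in each variable separately, i.e. for all $x_1,\dots,x_n,y\in L$ and $i\in\{1,\dots,n\}$, $T(x_1,\dots,x_{i-1},x_i\vee y,x_{i+1},\dots,x_n)=T(x_1,\dots,x_n)\vee T(x_1,\dots,x_{i-1},y,x_{i+1},\dots,x_n)$, and likewise with $\vee$ replaced by $\wedge$ throughout. $T$ is symmetric if its value is unchanged under every permutation of its arguments. A lattice homomorphism is a map preserving binary $\vee$ and $\wedge$. *)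

theory Defs
  imports "HOL-Combinatorics.Combinatorics"
begin

text \<open>Points of \<open>L\<^sup>n\<close> are lists of length \<open>n\<close>; a map on \<open>L\<^sup>n\<close> is a function on lists,
  whose values on lists of any other length are never referred to.\<close>

definition lattice_hom :: "('a::lattice \<Rightarrow> 'b::lattice) \<Rightarrow> bool" where
  "lattice_hom f \<longleftrightarrow>
     (\<forall>x y. f (sup x y) = sup (f x) (f y)) \<and>
     (\<forall>x y. f (inf x y) = inf (f x) (f y))"

definition lattice_n_hom :: "nat \<Rightarrow> ('a::lattice list \<Rightarrow> 'b::lattice) \<Rightarrow> bool" where
  "lattice_n_hom n T \<longleftrightarrow>
     (\<forall>xs y i. length xs = n \<longrightarrow> i < n \<longrightarrow>
        T (xs[i := sup (xs ! i) y]) = sup (T xs) (T (xs[i := y])) \<and>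
        T (xs[i := inf (xs ! i) y]) = inf (T xs) (T (xs[i := y])))"

definition symmetric_map :: "nat \<Rightarrow> ('a list \<Rightarrow> 'b) \<Rightarrow> bool" where
  "symmetric_map n T \<longleftrightarrow>
     (\<forall>xs p. length xs = n \<longrightarrow> p permutes {..<n} \<longrightarrow> T (permute_list p xs) = T xs)"

definition diagonal_map :: "nat \<Rightarrow> ('a list \<Rightarrow> 'b) \<Rightarrow> 'a \<Rightarrow> 'b" where
  "diagonal_map n T x = T (replicate n x)"

end

theory Submission
  imports Defs
begin

text \<open>Write \<open>u = x \<squnion> y\<close>, \<open>v = x \<sqinter> y\<close> and \<open>a\<^sub>k = T(x\<^sup>k, y\<^sup>n\<^sup>-\<^sup>k)\<close>. Expanding \<open>T(v\<^sup>q, u\<^sup>p)\<close> with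
  \<open>p + q = n\<close> in the two possible orders shows that the join over \<open>i \<le> p\<close> of the meets of the
  windows \<open>a\<^sub>i, \<dots>, a\<^sub>i\<^sub>+\<^sub>q\<close> equals the meet over \<open>j \<le> q\<close> of the joins of the windows
  \<open>a\<^sub>j, \<dots>, a\<^sub>j\<^sub>+\<^sub>p\<close>. A window of length \<open>q\<close> that avoids both \<open>0\<close> and \<open>n\<close> intersects every window of
  length \<open>p + 1\<close>, so its meet lies below \<open>T(v\<^sup>q, u\<^sup>p)\<close>, that is, below the join of the meets of the
  windows of length \<open>q + 1\<close>. Descending induction on the length bounds the meet of every window
  by \<open>a\<^sub>0 \<squnion> a\<^sub>n\<close>; windows of length one give \<open>T(u\<^sup>n) \<le> a\<^sub>0 \<squnion> a\<^sub>n\<close>. The statement for meets is dual.\<close>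

lemma symmetric_map_mset_cong:
  assumes "symmetric_map n T" "length xs = n" "mset xs = mset ys"
  shows "T xs = T ys"
proof -
  have len: "length ys = n"
    using assms(2,3) by (metis size_mset)
  obtain p where "p permutes {..<length ys}" "permute_list p ys = xs"
    using mset_eq_permutation[OF assms(3)] by blast
  then show ?thesis
    using assms(1) len unfolding symmetric_map_def by metis
qed

text \<open>Splitting every \<open>w\<close> yields 2^q conditions; by symmetry they collapse to
  \<open>q + 1\<close>, one for each number \<open>j\<close> of copies of \<open>x\<close>. In use,
  \<open>Q xs\<close> says that \<open>T xs\<close> has a given upper or lower bound.\<close>

lemma replicate_expansion:
  assumes sym: "\<And>xs ys. length xs = n \<Longrightarrow> mset xs = mset ys \<Longrightarrow> Q xs \<longleftrightarrow> Q ys"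
    and split: "\<And>xs. Suc (length xs) = n \<Longrightarrow> Q (w # xs) \<longleftrightarrow> Q (x # xs) \<and> Q (y # xs)"
    and "q + length zs = n"
  shows "Q (replicate q w @ zs) \<longleftrightarrow> (\<forall>j\<le>q. Q (replicate j x @ replicate (q - j) y @ zs))"
  using assms(3)
proof (induction q arbitrary: zs)
  case 0
  then show ?case by simp
next
  case (Suc q)
  have move: "Q (t # replicate q w @ zs) \<longleftrightarrow> Q (replicate q w @ t # zs)" for t
    using Suc.prems by (intro sym) auto
  have X: "Q (replicate j x @ replicate (q - j) y @ x # zs) \<longleftrightarrow>
      Q (replicate (Suc j) x @ replicate (Suc q - Suc j) y @ zs)" if "j \<le> q" for j
    using Suc.prems that by (intro sym) auto
  have Y: "Q (replicate j x @ replicate (q - j) y @ y # zs) \<longleftrightarrow>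
      Q (replicate j x @ replicate (Suc q - j) y @ zs)" if "j \<le> q" for j
    using Suc.prems that by (intro sym) (auto simp: Suc_diff_le)
  have "Q (replicate (Suc q) w @ zs) \<longleftrightarrow>
      Q (replicate q w @ x # zs) \<and> Q (replicate q w @ y # zs)"
    using split[of "replicate q w @ zs"] Suc.prems move by simp
  also have "\<dots> \<longleftrightarrow>
      (\<forall>j\<le>q. Q (replicate (Suc j) x @ replicate (Suc q - Suc j) y @ zs)) \<and>
      (\<forall>j\<le>q. Q (replicate j x @ replicate (Suc q - j) y @ zs))"
    using Suc.IH[of "x # zs"] Suc.IH[of "y # zs"] Suc.prems X Y by auto
  also have "\<dots> \<longleftrightarrow> (\<forall>j\<le>Suc q. Q (replicate j x @ replicate (Suc q - j) y @ zs))"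
  proof -
    have "(\<forall>j\<le>q. P (Suc j)) \<and> (\<forall>j\<le>q. P j) \<longleftrightarrow> (\<forall>j\<le>Suc q. P j)" for P :: "nat \<Rightarrow> bool"
      by (metis Suc_le_mono le_SucE le_SucI order_refl)
    then show ?thesis .
  qed
  finally show ?case .
qed

text \<open>Stated for an abstract preorder \<open>R\<close> so that it applies both to \<open>\<le>\<close> with
  \<open>(u, v) = (x \<squnion> y, x \<sqinter> y)\<close> and to \<open>\<ge>\<close> with \<open>(u, v) = (x \<sqinter> y, x \<squnion> y)\<close>.\<close>

lemma diagonal_bound_iff:
  assumes sym: "\<And>xs ys. length xs = n \<Longrightarrow> mset xs = mset ys \<Longrightarrow> T xs = T ys"
    and refl: "\<And>a. R a a" and trans: "\<And>a b c. R a b \<Longrightarrow> R b c \<Longrightarrow> R a c"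
    and u: "\<And>xs c. Suc (length xs) = n \<Longrightarrow> R (T (u # xs)) c \<longleftrightarrow> R (T (x # xs)) c \<and> R (T (y # xs)) c"
    and v: "\<And>xs c. Suc (length xs) = n \<Longrightarrow> R c (T (v # xs)) \<longleftrightarrow> R c (T (x # xs)) \<and> R c (T (y # xs))"
  shows "R (T (replicate n u)) c \<longleftrightarrow> R (T (replicate n x)) c \<and> R (T (replicate n y)) c"
proof -
  define a where "a k = T (replicate k x @ replicate (n - k) y)" for k
  \<comment> \<open>For \<open>q + i \<le> n\<close>, expanding \<open>v\<close> shows
    \<open>W q i\<close> to be an \<open>R\<close>-meet of the \<open>q + 1\<close> values
    \<open>a i\<close>, ..., \<open>a (i + q)\<close>.\<close>
  define W where "W q i = T (replicate q v @ replicate i x @ replicate (n - q - i) y)" for q i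
  have v_exp: "R b (T (replicate q v @ zs)) \<longleftrightarrow>
      (\<forall>j\<le>q. R b (T (replicate j x @ replicate (q - j) y @ zs)))"
    if "q + length zs = n" for q zs b
    using sym by (intro replicate_expansion[where n = n and Q = "\<lambda>xs. R b (T xs)"] v that) metis
  have u_exp: "R (T (replicate p u @ zs)) b \<longleftrightarrow>
      (\<forall>i\<le>p. R (T (replicate i x @ replicate (p - i) y @ zs)) b)"
    if "p + length zs = n" for p zs b
    using sym by (intro replicate_expansion[where n = n and Q = "\<lambda>xs. R (T xs) b"] u that) metis
  have diag: "R (T (replicate n u)) b \<longleftrightarrow> (\<forall>k\<le>n. R (a k) b)" for b
    using u_exp[of n "[]" b] by (simp add: a_def)
  have sorted: "T (replicate j x @ replicate (q - j) y @ replicate i x @ replicate (n - q - i) y)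
      = a (i + j)" if "q \<le> n" "j \<le> q" "i \<le> n - q" for q i j
  proof -
    have "replicate_mset (n - (i + j)) y
        = replicate_mset (q - j) y + replicate_mset (n - q - i) y"
      using that by (intro multiset_eqI) auto
    then show ?thesis
      unfolding a_def using that
      by (intro sym) (auto simp: multiset_eq_iff)
  qed
  have W_le: "R (W q i) (a (i + j))" if "q \<le> n" "j \<le> q" "i \<le> n - q" for q i j
    using v_exp[of q "replicate i x @ replicate (n - q - i) y" "W q i"] sorted[OF that] that refl
    by (auto simp: W_def)
  have a0: "a 0 = T (replicate n y)" and an: "a n = T (replicate n x)"
    by (simp_all add: a_def)
  have "R (T (replicate n u)) c" if c: "R (T (replicate n x)) c" "R (T (replicate n y)) c"
  proof -
    have "\<forall>i\<le>n - q. R (W q i) c" if "q \<le> n" for q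
      using that
    proof (induction q rule: inc_induct)
      case base
      have "R (W n 0) (a 0)" using W_le[of n 0 0] by simp
      then show ?case using c a0 trans by auto
    next
      case (step q)
      show ?case
      proof (intro allI impI)
        fix i assume i: "i \<le> n - q"
        \<comment> \<open>The window contains index 0, contains index \<open>n\<close>, or avoids
          both.\<close>
        consider "i = 0" | "i = n - q" | "1 \<le> i" "i \<le> n - Suc q"
          using i by linarith
        then show "R (W q i) c"
        proof cases
          case 1
          then show ?thesis using W_le[of q 0 0] step.hyps c a0 trans by auto
        next
          case 2
          then show ?thesis using W_le[of q q i] step.hyps c an trans by auto
        next
          case 3
          let ?p = "n - Suc q"
          \<comment> \<open>\<open>?M\<close> is expanded twice: in \<open>v\<close> to bound it
            from below by \<open>W q i\<close>, in \<open>u\<close> to bound it from above by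
            \<open>c\<close> through the windows \<open>W (Suc q) k\<close>.\<close>
          let ?M = "T (replicate (Suc q) v @ replicate ?p u)"
          have "R (W q i) (T (replicate j x @ replicate (Suc q - j) y @ replicate ?p u))"
            (is "R _ (T ?ys)") if j: "j \<le> Suc q" for j
          proof -
            \<comment> \<open>The windows from \<open>i\<close> to \<open>i + q\<close> and from
              \<open>j\<close> to \<open>j + ?p\<close> share the larger of \<open>i\<close> and
              \<open>j\<close>; \<open>1 \<le> i\<close> is what gives
              \<open>j - i \<le> q\<close>.\<close>
            have "\<exists>i' j'. i' \<le> ?p \<and> j' \<le> q \<and> i + j' = i' + j"
            proof (cases "j \<le> i")
              case True
              then show ?thesis using 3 by (intro exI[of _ "i - j"] exI[of _ 0]) auto
            next
              case False
              then show ?thesis using 3 j by (intro exI[of _ 0] exI[of _ "j - i"]) auto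
            qed
            then obtain i' j' where *: "i' \<le> ?p" "j' \<le> q" "i + j' = i' + j" by blast
            let ?zs = "replicate j x @ replicate (Suc q - j) y"
            have "T (replicate ?p u @ ?zs) = T ?ys"
              using j step.hyps by (intro sym) auto
            moreover have "R (T (replicate i' x @ replicate (?p - i') y @ ?zs))
                (T (replicate ?p u @ ?zs))"
              using u_exp[of ?p ?zs "T (replicate ?p u @ ?zs)"] refl j step.hyps *(1) by auto
            moreover have "T (replicate i' x @ replicate (?p - i') y @ ?zs)
                = T (?zs @ replicate i' x @ replicate (?p - i') y)"
              using j step.hyps *(1) by (intro sym) auto
            moreover have "\<dots> = a (i + j')"
              using sorted[of "Suc q" j i'] j step.hyps * by simp
            ultimately have "R (a (i + j')) (T ?ys)" by simp
            moreover have "R (W q i) (a (i + j'))"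
              using W_le[of q j' i] * i step.hyps by simp
            ultimately show ?thesis using trans by blast
          qed
          then have "R (W q i) ?M"
            using v_exp[of "Suc q" "replicate ?p u" "W q i"] step.hyps by simp
          moreover have "R ?M c"
          proof -
            have "?M = T (replicate ?p u @ replicate (Suc q) v)"
              using step.hyps by (intro sym) auto
            moreover have "T (replicate k x @ replicate (?p - k) y @ replicate (Suc q) v)
                = W (Suc q) k" if "k \<le> ?p" for k
              unfolding W_def using that step.hyps by (intro sym) auto
            ultimately show ?thesis
              using u_exp[of ?p "replicate (Suc q) v" c] step.IH step.hyps by simp
          qed
          ultimately show ?thesis using trans by blast
        qed
      qed
    qed
    from this[of 0] have "\<forall>k\<le>n. R (a k) c" by (simp add: W_def a_def)
    then show ?thesis using diag by blast
  qed
  moreover have "R (T (replicate n x)) c \<and> R (T (replicate n y)) c" if "R (T (replicate n u)) c"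
    using that diag a0 an by (metis le0 order_refl)
  ultimately show ?thesis by blast
qed

theorem theorem4p8:
  fixes T :: "'a::distrib_lattice list \<Rightarrow> 'b::distrib_lattice"
    and n :: nat
  assumes "n \<ge> 2"
    and "lattice_n_hom n T"
    and "symmetric_map n T"
  shows "lattice_hom (diagonal_map n T)"
proof -
  note sym = symmetric_map_mset_cong[OF assms(3)]
  have hd_sup: "T (sup x y # xs) = sup (T (x # xs)) (T (y # xs))"
    and hd_inf: "T (inf x y # xs) = inf (T (x # xs)) (T (y # xs))"
    if "Suc (length xs) = n" for x y xs
    using assms(2)[unfolded lattice_n_hom_def, rule_format, of "x # xs" 0 y] that by auto
  have "T (replicate n (sup x y)) \<le> c \<longleftrightarrow> T (replicate n x) \<le> c \<and> T (replicate n y) \<le> c" for x y c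
    by (rule diagonal_bound_iff[where v = "inf x y" and R = "(\<le>)"])
      (auto simp: hd_sup hd_inf intro: sym)
  \<comment> \<open>An element is determined by its upper bounds.\<close>
  then have "T (replicate n (sup x y)) = sup (T (replicate n x)) (T (replicate n y))" for x y
    by (intro antisym) (metis sup.cobounded1 sup.cobounded2, metis order_refl sup.boundedI)
  moreover
  have "c \<le> T (replicate n (inf x y)) \<longleftrightarrow> c \<le> T (replicate n x) \<and> c \<le> T (replicate n y)" for x y c
    by (rule diagonal_bound_iff[where v = "sup x y" and R = "(\<ge>)"])
      (auto simp: hd_sup hd_inf intro: sym)
  then have "T (replicate n (inf x y)) = inf (T (replicate n x)) (T (replicate n y))" for x y
    by (intro antisym) (metis order_refl inf.boundedI, metis inf.cobounded1 inf.cobounded2)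
  ultimately show ?thesis
    by (simp add: lattice_hom_def diagonal_map_def)
qed

end
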